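(* If $B$ is an infinite complete Boolean algebra, then $\mathsf{Log}_{\subseteq}^{\sharp}(B)=\mathsf{KTB}$.
   Context: Modal logic. The propositional modal language has a countable set $\mathsf{Prop}$ of propositional variables, the Boolean connectives, $\Box$ and $\Diamond$. $\mathsf{KTB}$ is the smallest normal modal logic containing $(T)$ $\Box\varphi\to\varphi$ and $(B)$ $\varphi\to\Box\Diamond\varphi$ (equivalently, the logic of reflexive symmetric Kripke frames), identified with its set of theorems. Boolean-valued models. For a complete Boolean algebra $B$ (bottom $0$, top $1$, complement $a^\ast$, $a\to b:=a^\ast\vee b$), define by transfinite recursion $V^{(B)}_\alpha=\{x: x$ is a function, $\mathrm{ran}(x)\subseteq B$, and $\mathrm{dom}(x)\subseteq V^{(B)}_\xi$ for some $\xi<\alpha\}$ and $V^{(B)}=\bigcup_\alpha V^{(B)}_\alpha$. $L_B$ is the first-order language of set theory expanded by a constant symbol for each element of $V^{(B)}$, and $\mathsf{Sent}(L_B)$ is the class of its sentences. The Boolean value $\llbracket\cdot\rrbracket_B:\mathsf{Sent}(L_B)\to B$ is defined recursively by $\llbracket u\in v\rrbracket_B=\bigvee_{x\in\mathrm{dom}(v)}(v(x)\wedge\llbracket x=u\rrbracket_B)$, $\llbracket u=v\rrbracket_B=\bigwedge_{x\in\mathrm{dom}(u)}(u(x)\to\llbracket x\in v\rrbracket_B)\wedge\bigwedge_{y\in\mathrm{dom}(v)}(v(y)\to\llbracket y\in u\rrbracket_B)$, the Boolean operations for the connectives, and meets (resp. joins) over $V^{(B)}$ for $\forall$ (resp.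 $\exists$). Translation models. $B^+:=B\setminus\{0\}$. A $B$-translation is a map $T:\mathsf{Prop}\to\mathsf{Sent}(L_B)$; it induces $v_T:\mathsf{Prop}\to B$, $v_T(p)=\llbracket T(p)\rrbracket_B$. For nonempty $W\subseteq B^+$, $M_{B,W,T}$ is the Kripke model with set of states $W$, accessibility $aRb\iff a\wedge b\neq 0$, and atomic satisfaction $M_{B,W,T},b\models p\iff b\le v_T(p)$; other connectives and modalities are interpreted by the usual Kripke clauses. $M_{B,W,T}\models\varphi$ means that $\varphi$ holds at every $b\in W$. $\mathsf{Log}_{\subseteq}^{\sharp}(B)$ is the set of modal formulas $\varphi$ such that $M_{B,W,T}\models\varphi$ for all nonempty $W\subseteq B^+$ and all $B$-translations $T$. *)

theory Defs
  imports "HOL-Library.Countable" "HOL-Library.Multiset" "HOL-Library.Infinite_Typeclass"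
begin

unbundle lattice_syntax

section \<open>Modal logic\<close>

datatype 'p mform =
    Var 'p
  | Falsum
  | Neg "'p mform"
  | And "'p mform" "'p mform"
  | Or "'p mform" "'p mform"
  | Imp "'p mform" "'p mform"
  | Box "'p mform"
  | Dia "'p mform"

abbreviation Iff :: "'p mform \<Rightarrow> 'p mform \<Rightarrow> 'p mform" where
  "Iff \<phi> \<psi> \<equiv> And (Imp \<phi> \<psi>) (Imp \<psi> \<phi>)"

primrec msubst :: "('p \<Rightarrow> 'p mform) \<Rightarrow> 'p mform \<Rightarrow> 'p mform" where
  "msubst \<sigma> (Var p) = \<sigma> p"
| "msubst \<sigma> Falsum = Falsum"
| "msubst \<sigma> (Neg \<phi>) = Neg (msubst \<sigma> \<phi>)"
| "msubst \<sigma> (And \<phi> \<psi>) = And (msubst \<sigma> \<phi>) (msubst \<sigma> \<psi>)"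
| "msubst \<sigma> (Or \<phi> \<psi>) = Or (msubst \<sigma> \<phi>) (msubst \<sigma> \<psi>)"
| "msubst \<sigma> (Imp \<phi> \<psi>) = Imp (msubst \<sigma> \<phi>) (msubst \<sigma> \<psi>)"
| "msubst \<sigma> (Box \<phi>) = Box (msubst \<sigma> \<phi>)"
| "msubst \<sigma> (Dia \<phi>) = Dia (msubst \<sigma> \<phi>)"

text \<open>Propositional evaluation, with boxed and diamond formulas treated as additional atoms:
  only the values of \<open>I\<close> at formulas of the form \<open>Var p\<close>, \<open>Box \<phi>\<close>, \<open>Dia \<phi>\<close> are used.\<close>

primrec prop_eval :: "('p mform \<Rightarrow> bool) \<Rightarrow> 'p mform \<Rightarrow> bool" where
  "prop_eval I (Var p) = I (Var p)"
| "prop_eval I Falsum = False"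
| "prop_eval I (Neg \<phi>) = (\<not> prop_eval I \<phi>)"
| "prop_eval I (And \<phi> \<psi>) = (prop_eval I \<phi> \<and> prop_eval I \<psi>)"
| "prop_eval I (Or \<phi> \<psi>) = (prop_eval I \<phi> \<or> prop_eval I \<psi>)"
| "prop_eval I (Imp \<phi> \<psi>) = (prop_eval I \<phi> \<longrightarrow> prop_eval I \<psi>)"
| "prop_eval I (Box \<phi>) = I (Box \<phi>)"
| "prop_eval I (Dia \<phi>) = I (Dia \<phi>)"

definition tautology :: "'p mform \<Rightarrow> bool" where
  "tautology \<phi> \<longleftrightarrow> (\<forall>I. prop_eval I \<phi>)"

text \<open>As both modalities are primitive, their duality is one of the axioms.\<close>

definition normal_modal_logic :: "'p mform set \<Rightarrow> bool" where
  "normal_modal_logic L \<longleftrightarrow>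
     (\<forall>\<phi>. tautology \<phi> \<longrightarrow> \<phi> \<in> L) \<and>
     (\<forall>\<phi> \<psi>. Imp (Box (Imp \<phi> \<psi>)) (Imp (Box \<phi>) (Box \<psi>)) \<in> L) \<and>
     (\<forall>\<phi>. Iff (Dia \<phi>) (Neg (Box (Neg \<phi>))) \<in> L) \<and>
     (\<forall>\<phi> \<psi>. Imp \<phi> \<psi> \<in> L \<longrightarrow> \<phi> \<in> L \<longrightarrow> \<psi> \<in> L) \<and>
     (\<forall>\<phi>. \<phi> \<in> L \<longrightarrow> Box \<phi> \<in> L) \<and>
     (\<forall>\<sigma> \<phi>. \<phi> \<in> L \<longrightarrow> msubst \<sigma> \<phi> \<in> L)"

definition KTB :: "'p mform set" where
  "KTB = \<Inter> {L. normal_modal_logic L \<and>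
               (\<forall>\<phi>. Imp (Box \<phi>) \<phi> \<in> L) \<and>
               (\<forall>\<phi>. Imp \<phi> (Box (Dia \<phi>)) \<in> L)}"

text \<open>Satisfaction at a state of the Kripke model with set of states \<open>W\<close>, accessibility \<open>R\<close>
  (restricted to \<open>W\<close>), and \<open>V p b\<close> expressing that \<open>p\<close> is true at \<open>b\<close>.\<close>

primrec sat :: "'w set \<Rightarrow> ('w \<Rightarrow> 'w \<Rightarrow> bool) \<Rightarrow> ('p \<Rightarrow> 'w \<Rightarrow> bool) \<Rightarrow> 'w \<Rightarrow> 'p mform \<Rightarrow> bool" where
  "sat W R V w (Var p) = V p w"
| "sat W R V w Falsum = False"
| "sat W R V w (Neg \<phi>) = (\<not> sat W R V w \<phi>)"
| "sat W R V w (And \<phi> \<psi>) = (sat W R V w \<phi> \<and> sat W R V w \<psi>)"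
| "sat W R V w (Or \<phi> \<psi>) = (sat W R V w \<phi> \<or> sat W R V w \<psi>)"
| "sat W R V w (Imp \<phi> \<psi>) = (sat W R V w \<phi> \<longrightarrow> sat W R V w \<psi>)"
| "sat W R V w (Box \<phi>) = (\<forall>w'\<in>W. R w w' \<longrightarrow> sat W R V w' \<phi>)"
| "sat W R V w (Dia \<phi>) = (\<exists>w'\<in>W. R w w' \<and> sat W R V w' \<phi>)"


section \<open>Universes of sets\<close>

text \<open>HOL has no class of all sets, so the ambient set theory is an arbitrary type carrying a
  membership relation that satisfies the second-order form of the ZFC axioms. Power set is not
  required: it is not needed to define the Boolean-valued universe. Hence every (second-order)
  model of ZFC is covered, in particular every Grothendieck universe, and the class still
  has instances in plain HOL (see the end of this theory). Choice and collection follow from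
  replacement and the choice operator of HOL.\<close>

class set_universe =
  fixes mem :: "'a \<Rightarrow> 'a \<Rightarrow> bool"  (infix "\<in>\<^sub>V" 50)
  assumes extensionality: "(\<forall>z. z \<in>\<^sub>V x \<longleftrightarrow> z \<in>\<^sub>V y) \<Longrightarrow> x = y"
    and foundation: "wf {(x, y). x \<in>\<^sub>V y}"
    and pairing: "\<exists>z. \<forall>x. x \<in>\<^sub>V z \<longleftrightarrow> x = a \<or> x = b"
    and union: "\<exists>u. \<forall>x. x \<in>\<^sub>V u \<longleftrightarrow> (\<exists>y. x \<in>\<^sub>V y \<and> y \<in>\<^sub>V a)"
    and separation: "\<exists>s. \<forall>x. x \<in>\<^sub>V s \<longleftrightarrow> x \<in>\<^sub>V a \<and> P x"
    and replacement: "\<exists>r. \<forall>y. y \<in>\<^sub>V r \<longleftrightarrow> (\<exists>x. x \<in>\<^sub>V a \<and> y = F x)"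
    and infinity: "\<exists>w. (\<exists>e. (\<forall>x. \<not> x \<in>\<^sub>V e) \<and> e \<in>\<^sub>V w) \<and>
                     (\<forall>n. n \<in>\<^sub>V w \<longrightarrow> (\<exists>s. (\<forall>x. x \<in>\<^sub>V s \<longleftrightarrow> x \<in>\<^sub>V n \<or> x = n) \<and> s \<in>\<^sub>V w))"

definition elts :: "'v::set_universe \<Rightarrow> 'v set" where
  "elts x = {z. z \<in>\<^sub>V x}"

definition upair :: "'v::set_universe \<Rightarrow> 'v \<Rightarrow> 'v" where
  "upair a b = (THE z. elts z = {a, b})"

definition opair :: "'v::set_universe \<Rightarrow> 'v \<Rightarrow> 'v" where
  "opair a b = upair (upair a a) (upair a b)"

definition is_function :: "'v::set_universe \<Rightarrow> bool" where
  "is_function f \<longleftrightarrow>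
     (\<forall>z\<in>elts f. \<exists>a b. z = opair a b) \<and>
     (\<forall>a b b'. opair a b \<in>\<^sub>V f \<longrightarrow> opair a b' \<in>\<^sub>V f \<longrightarrow> b = b')"

definition fdom :: "'v::set_universe \<Rightarrow> 'v set" where
  "fdom f = {a. \<exists>b. opair a b \<in>\<^sub>V f}"

definition fran :: "'v::set_universe \<Rightarrow> 'v set" where
  "fran f = {b. \<exists>a. opair a b \<in>\<^sub>V f}"

definition transitive :: "'v::set_universe \<Rightarrow> bool" where
  "transitive x \<longleftrightarrow> (\<forall>y\<in>elts x. elts y \<subseteq> elts x)"

text \<open>By foundation, an ordinal is a transitive set of transitive sets.\<close>

definition ordinal :: "'v::set_universe \<Rightarrow> bool" where
  "ordinal x \<longleftrightarrow> transitive x \<and> (\<forall>y\<in>elts x. transitive y)"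

lemma elts_upair [simp]: "elts (upair a b) = {a, b}"
proof -
  obtain z where "\<forall>x. x \<in>\<^sub>V z \<longleftrightarrow> x = a \<or> x = b"
    using pairing by blast
  then have z: "elts z = {a, b}"
    by (auto simp: elts_def)
  have "z' = z" if "elts z' = {a, b}" for z'
    using that z by (intro extensionality) (simp add: elts_def set_eq_iff)
  with z show ?thesis
    unfolding upair_def by (rule theI)
qed

lemma wf_fdom: "wf {(x, y :: 'v::set_universe). x \<in> fdom y}"
proof (rule wf_subset)
  show "wf ({(x, y :: 'v). x \<in>\<^sub>V y}\<^sup>+)"
    by (rule wf_trancl[OF foundation])
  show "{(x, y :: 'v). x \<in> fdom y} \<subseteq> {(x, y). x \<in>\<^sub>V y}\<^sup>+"
  proof clarify
    fix x y :: 'v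
    assume "x \<in> fdom y"
    then obtain b where b: "opair x b \<in>\<^sub>V y"
      by (auto simp: fdom_def)
    have "x \<in> elts (upair x x)" "upair x x \<in> elts (opair x b)"
      by (simp_all add: opair_def)
    then have "(x, upair x x) \<in> {(x, y). x \<in>\<^sub>V y}" "(upair x x, opair x b) \<in> {(x, y). x \<in>\<^sub>V y}"
      by (simp_all add: elts_def)
    with b show "(x, y) \<in> {(x, y). x \<in>\<^sub>V y}\<^sup>+"
      by (intro trancl_into_trancl[OF trancl_into_trancl[OF r_into_trancl]]) auto
  qed
qed

lemma fdom_mult:
  assumes "x \<in> fdom u"
  shows "({#x, v#}, {#u, v#}) \<in> mult {(x, y). x \<in> fdom y}"
    and "({#x, v#}, {#v, u#}) \<in> mult {(x, y). x \<in> fdom y}"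
proof -
  show "({#x, v#}, {#u, v#}) \<in> mult {(x, y). x \<in> fdom y}"
    using assms one_step_implies_mult[of "{#u#}" "{#x#}" "{(x, y). x \<in> fdom y}" "{#v#}"]
    by (simp add: add_mset_commute)
  then show "({#x, v#}, {#v, u#}) \<in> mult {(x, y). x \<in> fdom y}"
    by (simp add: add_mset_commute)
qed


section \<open>The Boolean-valued universe\<close>

text \<open>A complete Boolean algebra is a type of sort \<open>{boolean_algebra, complete_lattice}\<close>; the
  library class \<open>complete_boolean_algebra\<close> also demands complete distributivity, which
  forces atomicity. To form \<open>B\<close>-valued functions inside a universe, the algebra
  is identified with a set of the universe along an injection \<open>c\<close>.\<close>

definition coded_as_set :: "('b \<Rightarrow> 'v::set_universe) \<Rightarrow> bool" where
  "coded_as_set c \<longleftrightarrow> inj c \<and> (\<exists>s. elts s = range c)"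

definition val :: "('b \<Rightarrow> 'v::set_universe) \<Rightarrow> 'v \<Rightarrow> 'v \<Rightarrow> 'b" where
  "val c f a = (THE b. opair a (c b) \<in>\<^sub>V f)"

function VB_level :: "('b \<Rightarrow> 'v::set_universe) \<Rightarrow> 'v \<Rightarrow> 'v set" where
  "VB_level c \<alpha> =
     {x. is_function x \<and> fran x \<subseteq> range c \<and> (\<exists>\<xi>\<in>elts \<alpha>. fdom x \<subseteq> VB_level c \<xi>)}"
  by pat_completeness auto
termination
  by (relation "inv_image {(x, y). x \<in>\<^sub>V y} snd") (auto simp: foundation elts_def)

declare VB_level.simps [simp del]

definition VB :: "('b \<Rightarrow> 'v::set_universe) \<Rightarrow> 'v set" where
  "VB c = (\<Union>\<alpha>\<in>{\<alpha>. ordinal \<alpha>}. VB_level c \<alpha>)"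

function bmem :: "('b::{boolean_algebra,complete_lattice} \<Rightarrow> 'v::set_universe) \<Rightarrow> 'v \<Rightarrow> 'v \<Rightarrow> 'b"
  and beq :: "('b::{boolean_algebra,complete_lattice} \<Rightarrow> 'v::set_universe) \<Rightarrow> 'v \<Rightarrow> 'v \<Rightarrow> 'b" where
  "bmem c u v = (\<Squnion>x\<in>fdom v. val c v x \<sqinter> beq c x u)"
| "beq c u v = (\<Sqinter>x\<in>fdom u. - val c u x \<squnion> bmem c x v) \<sqinter> (\<Sqinter>y\<in>fdom v. - val c v y \<squnion> bmem c y u)"
  by pat_completeness auto
termination
  by (relation "inv_image (mult {(x, y). x \<in> fdom y})
        (\<lambda>p. case p of Inl (c, u, v) \<Rightarrow> {#u, v#} | Inr (c, u, v) \<Rightarrow> {#u, v#})")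
    (auto intro: wf_mult wf_fdom fdom_mult)

declare bmem.simps [simp del] beq.simps [simp del]

datatype 'v trm = Variable nat | Const 'v

datatype 'v form =
    FMem "'v trm" "'v trm"
  | FEq "'v trm" "'v trm"
  | FNot "'v form"
  | FConj "'v form" "'v form"
  | FDisj "'v form" "'v form"
  | FImp "'v form" "'v form"
  | FAll nat "'v form"
  | FEx nat "'v form"

primrec trm_vars :: "'v trm \<Rightarrow> nat set" where
  "trm_vars (Variable n) = {n}"
| "trm_vars (Const u) = {}"

primrec free_vars :: "'v form \<Rightarrow> nat set" where
  "free_vars (FMem s t) = trm_vars s \<union> trm_vars t"
| "free_vars (FEq s t) = trm_vars s \<union> trm_vars t"
| "free_vars (FNot \<phi>) = free_vars \<phi>"
| "free_vars (FConj \<phi> \<psi>) = free_vars \<phi> \<union> free_vars \<psi>"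
| "free_vars (FDisj \<phi> \<psi>) = free_vars \<phi> \<union> free_vars \<psi>"
| "free_vars (FImp \<phi> \<psi>) = free_vars \<phi> \<union> free_vars \<psi>"
| "free_vars (FAll n \<phi>) = free_vars \<phi> - {n}"
| "free_vars (FEx n \<phi>) = free_vars \<phi> - {n}"

definition Sent :: "('b \<Rightarrow> 'v::set_universe) \<Rightarrow> 'v form set" where
  "Sent c = {\<phi>. set_form \<phi> \<subseteq> VB c \<and> free_vars \<phi> = {}}"

primrec trm_inst :: "nat \<Rightarrow> 'v \<Rightarrow> 'v trm \<Rightarrow> 'v trm" where
  "trm_inst n u (Variable m) = (if m = n then Const u else Variable m)"
| "trm_inst n u (Const w) = Const w"

text \<open>\<open>inst n u \<phi>\<close> substitutes the constant \<open>u\<close> for the free occurrences of variable \<open>n\<close>.\<close>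

primrec inst :: "nat \<Rightarrow> 'v \<Rightarrow> 'v form \<Rightarrow> 'v form" where
  "inst n u (FMem s t) = FMem (trm_inst n u s) (trm_inst n u t)"
| "inst n u (FEq s t) = FEq (trm_inst n u s) (trm_inst n u t)"
| "inst n u (FNot \<phi>) = FNot (inst n u \<phi>)"
| "inst n u (FConj \<phi> \<psi>) = FConj (inst n u \<phi>) (inst n u \<psi>)"
| "inst n u (FDisj \<phi> \<psi>) = FDisj (inst n u \<phi>) (inst n u \<psi>)"
| "inst n u (FImp \<phi> \<psi>) = FImp (inst n u \<phi>) (inst n u \<psi>)"
| "inst n u (FAll m \<phi>) = FAll m (if m = n then \<phi> else inst n u \<phi>)"
| "inst n u (FEx m \<phi>) = FEx m (if m = n then \<phi> else inst n u \<phi>)"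

primrec height :: "'v form \<Rightarrow> nat" where
  "height (FMem s t) = 0"
| "height (FEq s t) = 0"
| "height (FNot \<phi>) = Suc (height \<phi>)"
| "height (FConj \<phi> \<psi>) = Suc (height \<phi> + height \<psi>)"
| "height (FDisj \<phi> \<psi>) = Suc (height \<phi> + height \<psi>)"
| "height (FImp \<phi> \<psi>) = Suc (height \<phi> + height \<psi>)"
| "height (FAll n \<phi>) = Suc (height \<phi>)"
| "height (FEx n \<phi>) = Suc (height \<phi>)"

lemma height_inst [simp]: "height (inst n u \<phi>) = height \<phi>"
  by (induction \<phi>) auto

text \<open>The Boolean value of a sentence. Atomic formulas with a variable, which are not sentences,
  get the irrelevant value \<open>\<bottom>\<close>.\<close>

function bval :: "('b::{boolean_algebra,complete_lattice} \<Rightarrow> 'v::set_universe) \<Rightarrow> 'v form \<Rightarrow> 'b" where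
  "bval c (FMem s t) = (case (s, t) of (Const u, Const v) \<Rightarrow> bmem c u v | _ \<Rightarrow> \<bottom>)"
| "bval c (FEq s t) = (case (s, t) of (Const u, Const v) \<Rightarrow> beq c u v | _ \<Rightarrow> \<bottom>)"
| "bval c (FNot \<phi>) = - bval c \<phi>"
| "bval c (FConj \<phi> \<psi>) = bval c \<phi> \<sqinter> bval c \<psi>"
| "bval c (FDisj \<phi> \<psi>) = bval c \<phi> \<squnion> bval c \<psi>"
| "bval c (FImp \<phi> \<psi>) = - bval c \<phi> \<squnion> bval c \<psi>"
| "bval c (FAll n \<phi>) = (\<Sqinter>u\<in>VB c. bval c (inst n u \<phi>))"
| "bval c (FEx n \<phi>) = (\<Squnion>u\<in>VB c. bval c (inst n u \<phi>))"
  by pat_completeness auto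
termination
  by (relation "measure (\<lambda>(c, \<phi>). height \<phi>)") auto


section \<open>Translation models\<close>

definition translation :: "('b \<Rightarrow> 'v::set_universe) \<Rightarrow> ('p \<Rightarrow> 'v form) \<Rightarrow> bool" where
  "translation c T \<longleftrightarrow> (\<forall>p. T p \<in> Sent c)"

definition induced_val ::
  "('b::{boolean_algebra,complete_lattice} \<Rightarrow> 'v::set_universe) \<Rightarrow> ('p \<Rightarrow> 'v form) \<Rightarrow> 'p \<Rightarrow> 'b" where
  "induced_val c T p = bval c (T p)"

definition translation_sat ::
  "('b::{boolean_algebra,complete_lattice} \<Rightarrow> 'v::set_universe) \<Rightarrow> 'b set \<Rightarrow> ('p \<Rightarrow> 'v form)
     \<Rightarrow> 'b \<Rightarrow> 'p mform \<Rightarrow> bool" where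
  "translation_sat c W T = sat W (\<lambda>a b. a \<sqinter> b \<noteq> \<bottom>) (\<lambda>p b. b \<le> induced_val c T p)"

definition translation_valid ::
  "('b::{boolean_algebra,complete_lattice} \<Rightarrow> 'v::set_universe) \<Rightarrow> 'b set \<Rightarrow> ('p \<Rightarrow> 'v form)
     \<Rightarrow> 'p mform \<Rightarrow> bool" where
  "translation_valid c W T \<phi> \<longleftrightarrow> (\<forall>b\<in>W. translation_sat c W T b \<phi>)"

definition Log_sub_sharp ::
  "('b::{boolean_algebra,complete_lattice} \<Rightarrow> 'v::set_universe) \<Rightarrow> 'p mform set" where
  "Log_sub_sharp c =
     {\<phi>. \<forall>W T. W \<noteq> {} \<longrightarrow> W \<subseteq> UNIV - {\<bottom>} \<longrightarrow> translation c T \<longrightarrow> translation_valid c W T \<phi>}"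


section \<open>Universes exist\<close>

text \<open>The assumptions on universes are satisfiable, for every infinite complete Boolean algebra:
  the sets of hereditary size at most the cardinality of an infinite type \<open>'i\<close> form a universe,
  and \<open>'i\<close> itself can be coded as a set of it. They are obtained from trees of branching at most
  that cardinality, modulo extensional equality.\<close>

lemma infinite_square: "\<exists>h :: 'i::infinite \<Rightarrow> 'i \<times> 'i. surj h"
proof -
  have inf: "\<not> finite (UNIV :: 'i set)" by (rule infinite_UNIV)
  have "(card_of ((UNIV :: 'i set) \<times> (UNIV :: 'i set)), card_of (UNIV :: 'i set)) \<in> ordIso"
    by (rule card_of_Times_same_infinite[OF inf])
  then have 1: "(card_of (UNIV :: 'i set), card_of ((UNIV :: 'i set) \<times> (UNIV :: 'i set))) \<in> ordIso"
    by (rule ordIso_symmetric)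
  obtain h where 2: "bij_betw h (UNIV :: 'i set) ((UNIV :: 'i set) \<times> (UNIV :: 'i set))"
    using iffD2[OF card_of_ordIso 1] by (rule exE)
  have "range h = UNIV"
    using bij_betw_imp_surj_on[OF 2] by (simp only: UNIV_Times_UNIV)
  show ?thesis by (rule exI[of _ h]) fact
qed

datatype 'i tree = Node "'i \<Rightarrow> 'i tree option"

primrec children :: "'i tree \<Rightarrow> 'i tree set" where
  "children (Node f) = {t. \<exists>i. f i = Some t}"

inductive teq :: "'i tree \<Rightarrow> 'i tree \<Rightarrow> bool" where
  "\<lbrakk>\<forall>s\<in>children x. \<exists>t\<in>children y. teq s t; \<forall>t\<in>children y. \<exists>s\<in>children x. teq s t\<rbrakk> \<Longrightarrow> teq x y"

lemma teq_iff:
  "teq x y \<longleftrightarrow> (\<forall>s\<in>children x. \<exists>t\<in>children y. teq s t) \<and> (\<forall>t\<in>children y. \<exists>s\<in>children x. teq s t)"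
  by (subst teq.simps) auto

lemma tree_induct [case_names step]:
  assumes "\<And>x. (\<And>s. s \<in> children x \<Longrightarrow> P s) \<Longrightarrow> P x"
  shows "P x"
proof (induction x)
  case (Node f)
  show ?case
  proof (rule assms)
    fix s assume "s \<in> children (Node f)"
    then obtain i where "f i = Some s" by auto
    then show "P s" using Node.IH[of "f i" s] by (metis option.set_intros rangeI)
  qed
qed

lemma teq_refl: "teq x x"
  by (induction x rule: tree_induct) (subst teq_iff, blast)

lemma teq_sym: "teq x y \<Longrightarrow> teq y x"
  by (induction rule: teq.induct) (subst teq_iff, blast)

lemma teq_trans: "teq x y \<Longrightarrow> teq y z \<Longrightarrow> teq x z"
proof (induction x arbitrary: y z rule: tree_induct)
  case (step x)
  have xy: "\<forall>s\<in>children x. \<exists>t\<in>children y. teq s t" "\<forall>t\<in>children y. \<exists>s\<in>children x. teq s t"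
    using step.prems(1) teq_iff by blast+
  have yz: "\<forall>s\<in>children y. \<exists>t\<in>children z. teq s t" "\<forall>t\<in>children z. \<exists>s\<in>children y. teq s t"
    using step.prems(2) teq_iff by blast+
  show ?case
  proof (rule teq.intros)
    show "\<forall>s\<in>children x. \<exists>t\<in>children z. teq s t"
      using xy(1) yz(1) step.IH by blast
    show "\<forall>t\<in>children z. \<exists>s\<in>children x. teq s t"
      using xy(2) yz(2) step.IH by blast
  qed
qed

quotient_type 'i hset = "'i tree" / teq
  by (intro equivpI reflpI sympI transpI) (fact teq_refl teq_sym teq_trans)+

lemma children_exists:
  fixes A :: "'i tree set"
  assumes "\<exists>g :: 'i \<Rightarrow> 'i tree. A \<subseteq> range g"
  shows "\<exists>x. children x = A"
proof -
  obtain g :: "'i \<Rightarrow> 'i tree" where "A \<subseteq> range g"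
    using assms by blast
  then show ?thesis
    by (intro exI[of _ "Node (\<lambda>i. if g i \<in> A then Some (g i) else None)"]) (auto simp: image_iff split: if_splits)
qed

definition hmem :: "'i hset \<Rightarrow> 'i hset \<Rightarrow> bool" where
  "hmem x y \<longleftrightarrow> (\<exists>s\<in>children (rep_hset y). x = abs_hset s)"

lemma abs_eq: "abs_hset s = abs_hset t \<longleftrightarrow> teq s t"
  by (simp add: hset.abs_eq_iff)

lemma abs_rep: "abs_hset (rep_hset x) = x"
  by (rule Quotient3_abs_rep[OF Quotient3_hset])

lemma hmem_abs: "hmem x (abs_hset t) \<longleftrightarrow> (\<exists>s\<in>children t. x = abs_hset s)"
proof -
  have "teq (rep_hset (abs_hset t)) t"
    by (simp add: abs_eq[symmetric] abs_rep)
  then have "\<forall>s\<in>children (rep_hset (abs_hset t)). \<exists>s'\<in>children t. abs_hset s = abs_hset s'"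
    "\<forall>s'\<in>children t. \<exists>s\<in>children (rep_hset (abs_hset t)). abs_hset s = abs_hset s'"
    by (simp_all add: teq_iff[of "rep_hset (abs_hset t)"] abs_eq)
  then show ?thesis
    unfolding hmem_def by metis
qed

lemma hset_exists:
  fixes A :: "'i hset set"
  assumes "\<exists>g :: 'i \<Rightarrow> 'i hset. A \<subseteq> range g"
  shows "\<exists>x. \<forall>z. hmem z x \<longleftrightarrow> z \<in> A"
proof -
  have "\<exists>g :: 'i \<Rightarrow> 'i tree. rep_hset ` A \<subseteq> range g"
  proof -
    obtain g :: "'i \<Rightarrow> 'i hset" where "A \<subseteq> range g"
      using assms by blast
    then have "rep_hset ` A \<subseteq> range (rep_hset \<circ> g)" by auto
    then show ?thesis by (rule exI[where x = "rep_hset \<circ> g"])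
  qed
  from children_exists[OF this] obtain x where "children x = rep_hset ` A" ..
  then show ?thesis
    by (intro exI[of _ "abs_hset x"]) (auto simp: hmem_abs abs_rep)
qed

lemma hset_small: "\<exists>g :: 'i \<Rightarrow> 'i hset. {z. hmem z (x :: 'i hset)} \<subseteq> range g"
proof -
  obtain f where f: "rep_hset x = Node f" by (cases "rep_hset x")
  have "{z. hmem z x} \<subseteq> range (\<lambda>i. abs_hset (the (f i)))"
  proof
    fix z assume "z \<in> {z. hmem z x}"
    then obtain s where "s \<in> children (Node f)" "z = abs_hset s"
      unfolding hmem_def f mem_Collect_eq by (elim bexE)
    moreover from this obtain i where "f i = Some s"
      unfolding children.simps mem_Collect_eq by (elim exE)
    ultimately have "f i = Some s" "z = abs_hset s" by simp_all
    then show "z \<in> range (\<lambda>i. abs_hset (the (f i)))" by (intro range_eqI[of _ _ i]) simp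
  qed
  then show ?thesis by (rule exI[where x = "\<lambda>i. abs_hset (the (f i))"])
qed

instantiation hset :: (infinite) set_universe
begin

definition "mem_hset = (hmem :: 'a hset \<Rightarrow> 'a hset \<Rightarrow> bool)"

instance
proof
  fix x y a b :: "'a hset" and P :: "'a hset \<Rightarrow> bool" and F :: "'a hset \<Rightarrow> 'a hset"
  have two: "\<exists>i j :: 'a. i \<noteq> j"
    using ex_new_if_finite[OF infinite_UNIV, of "{undefined}"] by blast
  show "x = y" if "\<forall>z. z \<in>\<^sub>V x \<longleftrightarrow> z \<in>\<^sub>V y"
  proof -
    have xy: "hmem z x \<longleftrightarrow> hmem z y" for z
      using that by (simp add: mem_hset_def)
    have "teq (rep_hset x) (rep_hset y)"
    proof (rule teq.intros)
      show "\<forall>s\<in>children (rep_hset x). \<exists>t\<in>children (rep_hset y). teq s t"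
        using xy unfolding hmem_def abs_eq[symmetric] by blast
      show "\<forall>t\<in>children (rep_hset y). \<exists>s\<in>children (rep_hset x). teq s t"
        using xy unfolding hmem_def abs_eq[symmetric] by metis
    qed
    then show ?thesis
      using abs_eq[of "rep_hset x" "rep_hset y"] by (simp add: abs_rep)
  qed
  show "wf {(x, y :: 'a hset). x \<in>\<^sub>V y}"
  proof (rule wfUNIVI)
    fix Q :: "'a hset \<Rightarrow> bool" and x
    assume Q: "\<forall>x. (\<forall>y. (y, x) \<in> {(x, y). x \<in>\<^sub>V y} \<longrightarrow> Q y) \<longrightarrow> Q x"
    have "Q (abs_hset t)" for t
    proof (induction t rule: tree_induct)
      case (step t)
      then have "Q y" if "hmem y (abs_hset t)" for y
        using that by (auto simp: hmem_abs)
      then show ?case using Q[rule_format, of "abs_hset t"] by (simp add: mem_hset_def)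
    qed
    then show "Q x" by (metis abs_rep)
  qed
  show "\<exists>z. \<forall>x. x \<in>\<^sub>V z \<longleftrightarrow> x = a \<or> x = b"
  proof -
    obtain i j :: 'a where "i \<noteq> j" using two by blast
    then have "{a, b} \<subseteq> range (\<lambda>k. if k = i then a else b)" by auto
    then show ?thesis using hset_exists[of "{a, b}"] unfolding mem_hset_def by blast
  qed
  show "\<exists>u. \<forall>x. x \<in>\<^sub>V u \<longleftrightarrow> (\<exists>y. x \<in>\<^sub>V y \<and> y \<in>\<^sub>V a)"
  proof -
    obtain g :: "'a \<Rightarrow> 'a hset" where g: "{z. hmem z a} \<subseteq> range g" using hset_small by blast
    have "\<exists>f :: 'a \<Rightarrow> 'a hset. {z. hmem z y} \<subseteq> range f" for y :: "'a hset" using hset_small by blast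
    then obtain f :: "'a hset \<Rightarrow> 'a \<Rightarrow> 'a hset" where f: "\<And>y. {z. hmem z y} \<subseteq> range (f y)" by metis
    obtain h :: "'a \<Rightarrow> 'a \<times> 'a" where h: "surj h" using infinite_square by blast
    have "{x. \<exists>y. hmem x y \<and> hmem y a} \<subseteq> range (\<lambda>k. f (g (fst (h k))) (snd (h k)))"
    proof clarify
      fix x y assume "hmem x y" "hmem y a"
      then obtain i j where "y = g i" "x = f y j" using f g by blast
      moreover obtain k where "h k = (i, j)" using h by (metis surjD)
      ultimately show "x \<in> range (\<lambda>k. f (g (fst (h k))) (snd (h k)))"
        by (intro range_eqI[of _ _ k]) simp
    qed
    then show ?thesis
      using hset_exists[of "{x. \<exists>y. hmem x y \<and> hmem y a}"] unfolding mem_hset_def by blast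
  qed
  show "\<exists>s. \<forall>x. x \<in>\<^sub>V s \<longleftrightarrow> x \<in>\<^sub>V a \<and> P x"
  proof -
    obtain g :: "'a \<Rightarrow> 'a hset" where "{z. hmem z a} \<subseteq> range g" using hset_small by blast
    then have "{x. hmem x a \<and> P x} \<subseteq> range g" by blast
    then show ?thesis using hset_exists[of "{x. hmem x a \<and> P x}"] unfolding mem_hset_def by blast
  qed
  show "\<exists>r. \<forall>y. y \<in>\<^sub>V r \<longleftrightarrow> (\<exists>x. x \<in>\<^sub>V a \<and> y = F x)"
  proof -
    obtain g :: "'a \<Rightarrow> 'a hset" where "{z. hmem z a} \<subseteq> range g" using hset_small by blast
    then have "{y. \<exists>x. hmem x a \<and> y = F x} \<subseteq> range (F \<circ> g)" by auto
    then show ?thesis using hset_exists[of "{y. \<exists>x. hmem x a \<and> y = F x}"] unfolding mem_hset_def by blast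
  qed
  show "\<exists>w :: 'a hset. (\<exists>e. (\<forall>x. \<not> x \<in>\<^sub>V e) \<and> e \<in>\<^sub>V w) \<and>
          (\<forall>n. n \<in>\<^sub>V w \<longrightarrow> (\<exists>s. (\<forall>x. x \<in>\<^sub>V s \<longleftrightarrow> x \<in>\<^sub>V n \<or> x = n) \<and> s \<in>\<^sub>V w))"
  proof -
    obtain e :: "'a hset" where e: "\<And>z. \<not> hmem z e" using hset_exists[of "{}"] by auto
    have "\<exists>s. \<forall>z. hmem z s \<longleftrightarrow> hmem z n \<or> z = n" for n :: "'a hset"
    proof -
      obtain g :: "'a \<Rightarrow> 'a hset" where g: "{z. hmem z n} \<subseteq> range g" using hset_small by blast
      obtain h :: "'a \<Rightarrow> 'a \<times> 'a" where h: "surj h" using infinite_square by blast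
      obtain i j :: 'a where ij: "i \<noteq> j" using two by blast
      have "{z. hmem z n \<or> z = n} \<subseteq> range (\<lambda>k. if fst (h k) = i then n else g (snd (h k)))"
      proof
        fix z assume "z \<in> {z. hmem z n \<or> z = n}"
        then consider "z = n" | l where "z = g l" using g by blast
        then show "z \<in> range (\<lambda>k. if fst (h k) = i then n else g (snd (h k)))"
        proof cases
          case 1
          obtain k where "h k = (i, i)" using h by (metis surjD)
          then show ?thesis using 1 by (intro range_eqI[of _ _ k]) simp
        next
          case 2
          obtain k where "h k = (j, l)" using h by (metis surjD)
          then show ?thesis using 2 ij by (intro range_eqI[of _ _ k]) simp
        qed
      qed
      then show ?thesis using hset_exists[of "{z. hmem z n \<or> z = n}"] by blast
    qed
    then obtain S where S: "\<And>n z :: 'a hset. hmem z (S n) \<longleftrightarrow> hmem z n \<or> z = n" by metis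
    obtain q :: "nat \<Rightarrow> 'a" where "inj q"
      using infinite_countable_subset[OF infinite_UNIV] by blast
    then have "range (\<lambda>m. (S ^^ m) e) \<subseteq> range (\<lambda>i. (S ^^ (inv q i)) e)"
      by (metis (mono_tags, lifting) image_subsetI inv_f_f rangeI)
    then obtain w where w: "\<forall>z. hmem z w \<longleftrightarrow> z \<in> range (\<lambda>m. (S ^^ m) e)"
      using hset_exists by blast
    show ?thesis
    proof (rule exI[of _ w], intro conjI allI impI)
      show "\<exists>e. (\<forall>x. \<not> x \<in>\<^sub>V e) \<and> e \<in>\<^sub>V w"
        using e w by (auto simp: mem_hset_def intro!: exI[of _ e] range_eqI[of _ _ 0])
    next
      fix n assume "n \<in>\<^sub>V w"
      then obtain m where "n = (S ^^ m) e" using w by (auto simp: mem_hset_def)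
      then have "S n = (S ^^ Suc m) e" by simp
      then have "hmem (S n) w" using w by blast
      then show "\<exists>s. (\<forall>x. x \<in>\<^sub>V s \<longleftrightarrow> x \<in>\<^sub>V n \<or> x = n) \<and> s \<in>\<^sub>V w"
        using S unfolding mem_hset_def by blast
    qed
  qed
qed

end

lemma coded_as_set_exists: "\<exists>c :: 'i::infinite \<Rightarrow> 'i hset. coded_as_set c"
proof -
  obtain r where r: "well_order_on (UNIV :: 'i set) r"
    using well_order_on by blast
  have wf: "wf (r - Id)"
    using r by (simp add: well_order_on_def)
  define F where "F = (\<lambda>f (i :: 'i). SOME x :: 'i hset. \<forall>z. hmem z x \<longleftrightarrow> z \<in> f ` {j. (j, i) \<in> r - Id})"
  define c where "c = wfrec (r - Id) F"
  have c: "hmem z (c i) \<longleftrightarrow> z \<in> c ` {j. (j, i) \<in> r - Id}" for z i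
  proof -
    have cut: "cut c (r - Id) i ` {j. (j, i) \<in> r - Id} = c ` {j. (j, i) \<in> r - Id}"
      by (rule image_cong[OF refl]) (simp add: cut_apply)
    have "c i = F (cut c (r - Id) i) i"
      unfolding c_def by (rule wfrec[OF wf])
    then have eq: "(SOME x. \<forall>z. hmem z x \<longleftrightarrow> z \<in> c ` {j. (j, i) \<in> r - Id}) = c i"
      unfolding F_def cut by (rule sym)
    have "\<exists>x. \<forall>z. hmem z x \<longleftrightarrow> z \<in> c ` {j. (j, i) \<in> r - Id}"
      by (rule hset_exists) blast
    from someI_ex[OF this] show ?thesis
      unfolding eq by blast
  qed
  have irrefl: "\<not> hmem z z" for z :: "'i hset"
    using wf_not_refl[OF foundation, of z] by (simp add: mem_hset_def)
  have "inj c"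
  proof (rule injI, rule ccontr)
    fix i j assume "c i = c j" "i \<noteq> j"
    then have "(i, j) \<in> r - Id \<or> (j, i) \<in> r - Id"
      using r by (auto simp: well_order_on_def linear_order_on_def total_on_def)
    then have "hmem (c i) (c j) \<or> hmem (c j) (c i)"
      using c by blast
    then show False
      using irrefl \<open>c i = c j\<close> by metis
  qed
  moreover have "\<exists>s. elts s = range c"
    using hset_exists[of "range c"] by (auto simp: elts_def mem_hset_def)
  ultimately show ?thesis
    by (auto simp: coded_as_set_def)
qed

end

theory Submission
  imports Defs
begin

text \<open>If \<open>\<phi>\<close> is not in \<open>KTB\<close>, it fails in a finite reflexive symmetric model, whose states
  are the consistent sets of subformulas of \<open>\<phi>\<close>. An infinite Boolean algebra has arbitrarily large
  finite families of disjoint nonzero elements, so one can pick such an element for every edge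
  of the model and represent a state by the join of its edges: two joins meet iff the states are
  adjacent. The loop at a state lies below no other state, so that a set of states is recovered
  from the join of its members. Finally every \<open>b\<close> is the value of a sentence, namely of
  \<open>\<emptyset> \<in> {(\<emptyset>, b)}\<close>.\<close>

section \<open>Normal modal logics and frames\<close>

locale normal_logic =
  fixes L :: "'p mform set"
  assumes normal: "normal_modal_logic L"
begin

lemma taut: "(\<And>I. prop_eval I \<phi>) \<Longrightarrow> \<phi> \<in> L"
  using normal unfolding normal_modal_logic_def tautology_def by blast

lemma K: "Imp (Box (Imp \<phi> \<psi>)) (Imp (Box \<phi>) (Box \<psi>)) \<in> L"
  using normal unfolding normal_modal_logic_def by blast

lemma dual: "Iff (Dia \<phi>) (Neg (Box (Neg \<phi>))) \<in> L"
  using normal unfolding normal_modal_logic_def by blast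

lemma mp: "Imp \<phi> \<psi> \<in> L \<Longrightarrow> \<phi> \<in> L \<Longrightarrow> \<psi> \<in> L"
  using normal unfolding normal_modal_logic_def by blast

lemma nec: "\<phi> \<in> L \<Longrightarrow> Box \<phi> \<in> L"
  using normal unfolding normal_modal_logic_def by blast

text \<open>Modus ponens with a tautology. As \<open>prop_eval\<close> treats boxed and diamond
  formulas as atoms, \<open>conseq\<close> and \<open>conseq2\<close> let Boolean reasoning inside
  \<open>L\<close> be done by evaluation.\<close>

lemma conseq: "\<phi> \<in> L \<Longrightarrow> (\<And>I. prop_eval I \<phi> \<Longrightarrow> prop_eval I \<psi>) \<Longrightarrow> \<psi> \<in> L"
  by (rule mp[of \<phi>], rule taut) auto

lemma conseq2:
  assumes "\<phi> \<in> L" "\<psi> \<in> L" "\<And>I. prop_eval I \<phi> \<Longrightarrow> prop_eval I \<psi> \<Longrightarrow> prop_eval I \<theta>"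
  shows "\<theta> \<in> L"
  by (rule mp[OF _ assms(2)], rule conseq[OF assms(1)]) (use assms(3) in auto)

lemma box_mono:
  assumes "Imp \<phi> \<psi> \<in> L"
  shows "Imp (Box \<phi>) (Box \<psi>) \<in> L"
  using mp[OF K nec[OF assms]] .

text \<open>Propositional consequence carries over under a box: the tautology is necessitated and
  \<open>K\<close> distributes the box.\<close>

lemma imp_box_mono:
  assumes "Imp \<chi> (Box \<phi>) \<in> L" and "\<And>I. prop_eval I \<phi> \<Longrightarrow> prop_eval I \<psi>"
  shows "Imp \<chi> (Box \<psi>) \<in> L"
proof (rule conseq2[OF assms(1) box_mono])
  show "Imp \<phi> \<psi> \<in> L"
    by (rule taut) (use assms(2) in auto)
qed auto

end

section \<open>Finite conjunctions under a box\<close>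

primrec Conj :: "'p mform list \<Rightarrow> 'p mform" where
  "Conj [] = Neg Falsum"
| "Conj (\<phi> # \<phi>s) = And \<phi> (Conj \<phi>s)"

lemma prop_eval_Conj: "prop_eval I (Conj \<phi>s) \<longleftrightarrow> (\<forall>\<phi>\<in>set \<phi>s. prop_eval I \<phi>)"
  by (induction \<phi>s) auto

context normal_logic
begin

lemma Conj_mem: "set \<phi>s \<subseteq> L \<Longrightarrow> Conj \<phi>s \<in> L"
proof (induction \<phi>s)
  case Nil
  show ?case by (rule taut) simp
next
  case (Cons \<phi> \<phi>s)
  then have "\<phi> \<in> L" "Conj \<phi>s \<in> L" by auto
  then show ?case by (rule conseq2) simp
qed

lemma imp_box_Conj: "(\<And>\<phi>. \<phi> \<in> set \<phi>s \<Longrightarrow> Imp \<chi> (Box \<phi>) \<in> L) \<Longrightarrow> Imp \<chi> (Box (Conj \<phi>s)) \<in> L"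
proof (induction \<phi>s)
  case Nil
  have "Box (Conj []) \<in> L" by (intro nec Conj_mem) simp
  then show ?case by (rule conseq) simp
next
  case (Cons \<phi> \<phi>s)
  have 1: "Imp \<chi> (Box \<phi>) \<in> L" "Imp \<chi> (Box (Conj \<phi>s)) \<in> L"
    using Cons by auto
  \<comment> \<open>\<phi> propositionally entails that any formula implies its conjunction with
    \<phi>; this implication goes under the box, and \<open>K\<close> then detaches the
    conjunction.\<close>
  have 2: "Imp \<chi> (Box (Imp (Conj \<phi>s) (Conj (\<phi> # \<phi>s)))) \<in> L"
    by (rule imp_box_mono[OF 1(1)]) simp
  have "Imp \<chi> (Imp (Box (Conj \<phi>s)) (Box (Conj (\<phi> # \<phi>s)))) \<in> L"
    by (rule conseq2[OF 2 K[of "Conj \<phi>s" "Conj (\<phi> # \<phi>s)"]]) simp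
  then show ?case by (rule conseq2[OF _ 1(2)]) simp
qed

end

section \<open>Soundness for Kripke frames\<close>

lemma sat_eq_prop_eval: "sat W R V w \<phi> = prop_eval (sat W R V w) \<phi>"
  by (induction \<phi>) auto

lemma sat_msubst: "sat W R V w (msubst \<sigma> \<phi>) = sat W R (\<lambda>p u. sat W R V u (\<sigma> p)) w \<phi>"
  by (induction \<phi> arbitrary: w) auto

text \<open>By \<open>sat_msubst\<close>, substituting amounts to changing the valuation;
  quantifying over all \<open>V\<close> is what gives closure under substitution.\<close>

lemma normal_modal_logic_frame:
  "normal_modal_logic {\<phi>. \<forall>V. \<forall>w\<in>W. sat W R V w \<phi>}"
  unfolding normal_modal_logic_def tautology_def
proof (intro conjI allI impI)
  fix \<phi> :: "'a mform" assume "\<forall>I. prop_eval I \<phi>"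
  \<comment> \<open>Satisfaction at a fixed world is itself an interpretation of variables and modal
    formulas, so tautologies hold there.\<close>
  then show "\<phi> \<in> {\<phi>. \<forall>V. \<forall>w\<in>W. sat W R V w \<phi>}"
    by (simp add: sat_eq_prop_eval)
qed (auto simp: sat_msubst)

text \<open>\<open>b\<close> is a bounded morphism onto its image that respects atoms, so truth
  passes both ways. It will rename worlds to elements of the algebra.\<close>

lemma sat_cong_image:
  assumes "\<And>w u. w \<in> W \<Longrightarrow> u \<in> W \<Longrightarrow> R' (b w) (b u) \<longleftrightarrow> R w u"
    and "\<And>p w. w \<in> W \<Longrightarrow> V' p (b w) \<longleftrightarrow> V p w"
    and "w \<in> W"
  shows "sat (b ` W) R' V' (b w) \<phi> \<longleftrightarrow> sat W R V w \<phi>"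
  using assms(3) by (induction \<phi> arbitrary: w) (auto simp: assms(1,2))

lemma KTB_subset:
  assumes "normal_modal_logic L" "\<And>\<phi>. Imp (Box \<phi>) \<phi> \<in> L" "\<And>\<phi>. Imp \<phi> (Box (Dia \<phi>)) \<in> L"
  shows "KTB \<subseteq> L"
  unfolding KTB_def using assms by blast

lemma KTB_sound:
  assumes "\<phi> \<in> KTB" "w \<in> W" "\<And>u. u \<in> W \<Longrightarrow> R u u" "\<And>u v. R u v \<Longrightarrow> R v u"
  shows "sat W R V w \<phi>"
proof -
  have "KTB \<subseteq> {\<phi>. \<forall>V. \<forall>w\<in>W. sat W R V w \<phi>}"
    by (rule KTB_subset[OF normal_modal_logic_frame]) (use assms(3,4) in auto)
  then show ?thesis using assms(1,2) by blast
qed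

text \<open>\<open>KTB\<close> is an intersection of normal logics; being normal itself, it can be
  used as the logic of the canonical construction.\<close>

lemma normal_modal_logic_Inter:
  assumes "\<And>L. L \<in> C \<Longrightarrow> normal_modal_logic L"
  shows "normal_modal_logic (\<Inter>C)"
  unfolding normal_modal_logic_def
proof (intro conjI allI impI InterI)
  fix \<sigma> \<phi> L assume "\<phi> \<in> \<Inter>C" "L \<in> C"
  then show "msubst \<sigma> \<phi> \<in> L"
    using assms[of L] by (simp add: normal_modal_logic_def)
next
  fix \<phi> \<psi> L assume "Imp \<phi> \<psi> \<in> \<Inter>C" "\<phi> \<in> \<Inter>C" "L \<in> C"
  then have "normal_logic L" "Imp \<phi> \<psi> \<in> L" "\<phi> \<in> L"
    using assms by (auto intro: normal_logic.intro)
  then show "\<psi> \<in> L"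
    by (rule normal_logic.mp)
qed (use assms in \<open>simp_all add: normal_modal_logic_def\<close>)

lemma normal_modal_logic_KTB: "normal_modal_logic KTB"
  unfolding KTB_def by (rule normal_modal_logic_Inter) simp

lemma KTB_T: "Imp (Box \<phi>) \<phi> \<in> KTB"
  unfolding KTB_def by (rule InterI) simp

lemma KTB_B: "Imp \<phi> (Box (Dia \<phi>)) \<in> KTB"
  unfolding KTB_def by (rule InterI) simp


section \<open>Finite canonical models\<close>

primrec subforms :: "'p mform \<Rightarrow> 'p mform set" where
  "subforms (Var p) = {Var p}"
| "subforms Falsum = {Falsum}"
| "subforms (Neg \<phi>) = insert (Neg \<phi>) (subforms \<phi>)"
| "subforms (And \<phi> \<psi>) = insert (And \<phi> \<psi>) (subforms \<phi> \<union> subforms \<psi>)"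
| "subforms (Or \<phi> \<psi>) = insert (Or \<phi> \<psi>) (subforms \<phi> \<union> subforms \<psi>)"
| "subforms (Imp \<phi> \<psi>) = insert (Imp \<phi> \<psi>) (subforms \<phi> \<union> subforms \<psi>)"
| "subforms (Box \<phi>) = insert (Box \<phi>) (subforms \<phi>)"
| "subforms (Dia \<phi>) = insert (Dia \<phi>) (subforms \<phi>)"

lemma finite_subforms: "finite (subforms \<phi>)"
  by (induction \<phi>) auto

lemma subforms_refl: "\<phi> \<in> subforms \<phi>"
  by (cases \<phi>) auto

text \<open>A finite list of formulas takes the place of the whole language, so that each state is
  described by a single formula. For the refuted formula, \<open>xs\<close> will enumerate its
  subformulas.\<close>

locale finite_canonical = normal_logic L for L :: "'p mform set" +
  fixes xs :: "'p mform list"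
begin

definition char_form :: "'p mform set \<Rightarrow> 'p mform" where
  "char_form S = Conj (map (\<lambda>\<psi>. if \<psi> \<in> S then \<psi> else Neg \<psi>) xs)"

definition states :: "'p mform set set" where
  "states = {S. S \<subseteq> set xs \<and> Neg (char_form S) \<notin> L}"

text \<open>\<open>S\<close> sees \<open>U\<close> iff \<open>char_form S \<and> \<diamond> char_form U\<close> is consistent.\<close>

definition acc :: "'p mform set \<Rightarrow> 'p mform set \<Rightarrow> bool" where
  "acc S U \<longleftrightarrow> Imp (char_form S) (Box (Neg (char_form U))) \<notin> L"

lemma prop_eval_char_form:
  "prop_eval I (char_form S) \<longleftrightarrow> (\<forall>\<psi>\<in>set xs. \<psi> \<in> S \<longleftrightarrow> prop_eval I \<psi>)"
proof -
  have "prop_eval I (char_form S) \<longleftrightarrow>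
      (\<forall>\<psi>\<in>set xs. prop_eval I (if \<psi> \<in> S then \<psi> else Neg \<psi>))"
    by (simp only: char_form_def prop_eval_Conj set_map ball_simps)
  also have "\<dots> \<longleftrightarrow> (\<forall>\<psi>\<in>set xs. \<psi> \<in> S \<longleftrightarrow> prop_eval I \<psi>)"
    by (rule ball_cong[OF refl]) simp
  finally show ?thesis .
qed

lemma prop_eval_char_form_eq:
  "S \<subseteq> set xs \<Longrightarrow> prop_eval I (char_form S) \<longleftrightarrow> S = {\<psi> \<in> set xs. prop_eval I \<psi>}"
  unfolding prop_eval_char_form by blast

lemma finite_states: "finite states"
  unfolding states_def by (rule finite_subset[of _ "Pow (set xs)"]) auto

text \<open>Otherwise \<open>Neg (char_form S)\<close> would be a tautology and \<open>S\<close>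
  inconsistent. The evaluation settles the Boolean cases of \<open>truth\<close>.\<close>

lemma state_eval:
  assumes "S \<in> states"
  obtains I where "\<And>\<psi>. \<psi> \<in> set xs \<Longrightarrow> \<psi> \<in> S \<longleftrightarrow> prop_eval I \<psi>"
proof -
  have "\<not> (\<forall>I. prop_eval I (Neg (char_form S)))"
    using taut assms unfolding states_def by blast
  then obtain I where "prop_eval I (char_form S)"
    by auto
  then show ?thesis
    by (intro that[of I]) (simp add: prop_eval_char_form)
qed

text \<open>A propositional normal form: among subsets of \<open>set xs\<close>, an interpretation
  satisfies only the \<open>char_form\<close> of its own trace on \<open>xs\<close>, so excluding
  all traces outside \<open>D\<close> says that the trace lies in \<open>D\<close>. This reduces
  membership in \<open>L\<close> to statements about single sets.\<close>

lemma nonmembers_Conj: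
  obtains \<phi>s where "set \<phi>s = (\<lambda>U. Neg (char_form U)) ` (Pow (set xs) - D)"
    "\<And>I. prop_eval I (Conj \<phi>s) \<longleftrightarrow> {\<psi> \<in> set xs. prop_eval I \<psi>} \<in> D"
proof -
  have "finite ((\<lambda>U. Neg (char_form U)) ` (Pow (set xs) - D))"
    by simp
  then obtain \<phi>s where \<phi>s: "set \<phi>s = (\<lambda>U. Neg (char_form U)) ` (Pow (set xs) - D)"
    using finite_list by metis
  have "prop_eval I (Conj \<phi>s) \<longleftrightarrow> {\<psi> \<in> set xs. prop_eval I \<psi>} \<in> D" for I
  proof -
    have "prop_eval I (Conj \<phi>s) \<longleftrightarrow>
        (\<forall>U \<in> Pow (set xs) - D. \<not> prop_eval I (char_form U))"
      unfolding prop_eval_Conj \<phi>s by simp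
    also have "\<dots> \<longleftrightarrow> (\<forall>U \<in> Pow (set xs) - D. U \<noteq> {\<psi> \<in> set xs. prop_eval I \<psi>})"
      by (rule ball_cong[OF refl]) (simp add: prop_eval_char_form_eq)
    also have "\<dots> \<longleftrightarrow> {\<psi> \<in> set xs. prop_eval I \<psi>} \<in> D"
      by blast
    finally show ?thesis .
  qed
  with \<phi>s show ?thesis by (rule that)
qed

lemma mem_iff_states:
  assumes "\<phi> \<in> set xs"
  shows "\<phi> \<in> L \<longleftrightarrow> (\<forall>S\<in>states. \<phi> \<in> S)"
proof
  assume \<phi>: "\<phi> \<in> L"
  show "\<forall>S\<in>states. \<phi> \<in> S"
  proof (rule ballI, rule ccontr)
    fix S assume S: "S \<in> states" "\<phi> \<notin> S"
    have "Neg (char_form S) \<in> L"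
      by (rule conseq[OF \<phi>]) (use S assms in \<open>auto simp: prop_eval_char_form\<close>)
    with S show False by (simp add: states_def)
  qed
next
  assume *: "\<forall>S\<in>states. \<phi> \<in> S"
  obtain \<phi>s where \<phi>s: "set \<phi>s = (\<lambda>U. Neg (char_form U)) ` (Pow (set xs) - {S. \<phi> \<in> S})"
    "\<And>I. prop_eval I (Conj \<phi>s) \<longleftrightarrow> {\<psi> \<in> set xs. prop_eval I \<psi>} \<in> {S. \<phi> \<in> S}"
    by (rule nonmembers_Conj[of "{S. \<phi> \<in> S}"]) (rule that)
  \<comment> \<open>No subset of \<open>set xs\<close> that omits \<phi> is a state, so every
    conjunct is in \<open>L\<close>.\<close>
  have "Conj \<phi>s \<in> L"
    by (rule Conj_mem) (use * \<phi>s(1) in \<open>auto simp: states_def\<close>)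
  then show "\<phi> \<in> L"
    by (rule conseq) (use \<phi>s(2) in auto)
qed

text \<open>The existence lemma of the canonical model. Only the trace on \<open>xs\<close> has to
  determine \<theta>, so it also applies to \<open>Neg \<psi>\<close>, which may lie outside
  \<open>xs\<close>.\<close>

lemma imp_box_iff_acc:
  assumes "\<And>I. prop_eval I \<theta> \<longleftrightarrow> {\<psi> \<in> set xs. prop_eval I \<psi>} \<in> D"
  shows "Imp (char_form S) (Box \<theta>) \<in> L \<longleftrightarrow> (\<forall>U\<in>states. acc S U \<longrightarrow> U \<in> D)"
proof
  assume \<theta>: "Imp (char_form S) (Box \<theta>) \<in> L"
  show "\<forall>U\<in>states. acc S U \<longrightarrow> U \<in> D"
  proof (intro ballI impI, rule ccontr)
    fix U assume U: "U \<in> states" "acc S U" "U \<notin> D"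
    have "Imp (char_form S) (Box (Neg (char_form U))) \<in> L"
      by (rule imp_box_mono[OF \<theta>])
        (use U in \<open>auto simp: assms states_def prop_eval_char_form_eq\<close>)
    with U show False by (simp add: acc_def)
  qed
next
  assume *: "\<forall>U\<in>states. acc S U \<longrightarrow> U \<in> D"
  obtain \<phi>s where \<phi>s: "set \<phi>s = (\<lambda>U. Neg (char_form U)) ` (Pow (set xs) - D)"
    "\<And>I. prop_eval I (Conj \<phi>s) \<longleftrightarrow> {\<psi> \<in> set xs. prop_eval I \<psi>} \<in> D"
    by (rule nonmembers_Conj[of D]) (rule that)
  \<comment> \<open>If \<open>U\<close> is a state, this is the failure of \<open>acc S U\<close>;
    if not, \<open>Neg (char_form U)\<close> is in \<open>L\<close> and can be necessitated.\<close>
  have "Imp (char_form S) (Box (Neg (char_form U))) \<in> L" if "U \<subseteq> set xs" "U \<notin> D" for U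
  proof (cases "U \<in> states")
    case True
    then show ?thesis using * that by (auto simp: acc_def)
  next
    case False
    then have "Box (Neg (char_form U)) \<in> L"
      using that by (intro nec) (simp add: states_def)
    then show ?thesis by (rule conseq) simp
  qed
  then have "Imp (char_form S) (Box (Conj \<phi>s)) \<in> L"
    by (intro imp_box_Conj) (auto simp: \<phi>s(1))
  then show "Imp (char_form S) (Box \<theta>) \<in> L"
    by (rule imp_box_mono) (simp add: \<phi>s(2) assms)
qed

section \<open>The truth lemma\<close>

lemma state_imp_iff:
  assumes "S \<in> states" "\<psi> \<in> set xs"
  shows "Imp (char_form S) \<psi> \<in> L \<longleftrightarrow> \<psi> \<in> S"
proof
  assume *: "Imp (char_form S) \<psi> \<in> L"
  show "\<psi> \<in> S"
  proof (rule ccontr)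
    assume "\<psi> \<notin> S"
    then have "Neg (char_form S) \<in> L"
      by (intro conseq[OF *]) (use assms in \<open>auto simp: prop_eval_char_form\<close>)
    with assms(1) show False by (simp add: states_def)
  qed
next
  assume "\<psi> \<in> S"
  then show "Imp (char_form S) \<psi> \<in> L"
    by (intro taut) (use assms in \<open>auto simp: prop_eval_char_form\<close>)
qed

lemma state_imp_Neg_iff:
  assumes "S \<in> states" "\<psi> \<in> set xs"
  shows "Imp (char_form S) (Neg \<psi>) \<in> L \<longleftrightarrow> \<psi> \<notin> S"
proof
  assume *: "Imp (char_form S) (Neg \<psi>) \<in> L"
  show "\<psi> \<notin> S"
  proof
    assume "\<psi> \<in> S"
    then have "Neg (char_form S) \<in> L"
      by (intro conseq[OF *]) (use assms in \<open>auto simp: prop_eval_char_form\<close>)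
    with assms(1) show False by (simp add: states_def)
  qed
next
  assume "\<psi> \<notin> S"
  then show "Imp (char_form S) (Neg \<psi>) \<in> L"
    by (intro taut) (use assms in \<open>auto simp: prop_eval_char_form\<close>)
qed

lemma truth:
  assumes "subforms \<psi> \<subseteq> set xs" "S \<in> states"
  shows "sat states acc (\<lambda>p S. Var p \<in> S) S \<psi> \<longleftrightarrow> \<psi> \<in> S"
  using assms
proof (induction \<psi> arbitrary: S)
  case (Box \<psi>)
  have \<psi>: "\<psi> \<in> set xs" using Box.prems subforms_refl by auto
  have "sat states acc (\<lambda>p S. Var p \<in> S) S (Box \<psi>) \<longleftrightarrow>
      (\<forall>U\<in>states. acc S U \<longrightarrow> U \<in> {U. \<psi> \<in> U})"
    using Box by auto
  also have "\<dots> \<longleftrightarrow> Imp (char_form S) (Box \<psi>) \<in> L"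
    by (rule imp_box_iff_acc[symmetric]) (use \<psi> in auto)
  also have "\<dots> \<longleftrightarrow> Box \<psi> \<in> S"
    using state_imp_iff Box.prems by simp
  finally show ?case .
next
  case (Dia \<psi>)
  have \<psi>: "\<psi> \<in> set xs" using Dia.prems subforms_refl by auto
  \<comment> \<open>Negating the diamond claim makes it a box claim, with \<open>D\<close> the sets
    omitting \<psi>; \<open>dual\<close> translates back.\<close>
  have "\<not> sat states acc (\<lambda>p S. Var p \<in> S) S (Dia \<psi>) \<longleftrightarrow>
      (\<forall>U\<in>states. acc S U \<longrightarrow> U \<in> {U. \<psi> \<notin> U})"
    using Dia by auto
  also have "\<dots> \<longleftrightarrow> Imp (char_form S) (Box (Neg \<psi>)) \<in> L"
    by (rule imp_box_iff_acc[symmetric]) (use \<psi> in auto)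
  also have "\<dots> \<longleftrightarrow> Imp (char_form S) (Neg (Dia \<psi>)) \<in> L"
    by (rule iffI; erule conseq2[OF dual[of \<psi>]]) auto
  also have "\<dots> \<longleftrightarrow> Dia \<psi> \<notin> S"
    using state_imp_Neg_iff Dia.prems by simp
  finally show ?case by blast
next
  case (Var p)
  show ?case by simp
next
  case Falsum
  obtain I where I: "\<And>\<psi>. \<psi> \<in> set xs \<Longrightarrow> \<psi> \<in> S \<longleftrightarrow> prop_eval I \<psi>"
    using state_eval Falsum.prems(2) by blast
  with Falsum show ?case by simp
next
  case (Neg \<phi>)
  obtain I where I: "\<And>\<psi>. \<psi> \<in> set xs \<Longrightarrow> \<psi> \<in> S \<longleftrightarrow> prop_eval I \<psi>"
    using state_eval Neg.prems(2) by blast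
  have "\<phi> \<in> set xs" "Neg \<phi> \<in> set xs"
    using Neg.prems subforms_refl by auto
  with Neg show ?case by (simp add: I)
next
  case (And \<phi> \<psi>)
  obtain I where I: "\<And>\<psi>. \<psi> \<in> set xs \<Longrightarrow> \<psi> \<in> S \<longleftrightarrow> prop_eval I \<psi>"
    using state_eval And.prems(2) by blast
  have "\<phi> \<in> set xs" "\<psi> \<in> set xs" "And \<phi> \<psi> \<in> set xs"
    using And.prems subforms_refl by auto
  with And show ?case by (simp add: I)
next
  case (Or \<phi> \<psi>)
  obtain I where I: "\<And>\<psi>. \<psi> \<in> set xs \<Longrightarrow> \<psi> \<in> S \<longleftrightarrow> prop_eval I \<psi>"
    using state_eval Or.prems(2) by blast
  have "\<phi> \<in> set xs" "\<psi> \<in> set xs" "Or \<phi> \<psi> \<in> set xs"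
    using Or.prems subforms_refl by auto
  with Or show ?case by (simp add: I)
next
  case (Imp \<phi> \<psi>)
  obtain I where I: "\<And>\<psi>. \<psi> \<in> set xs \<Longrightarrow> \<psi> \<in> S \<longleftrightarrow> prop_eval I \<psi>"
    using state_eval Imp.prems(2) by blast
  have "\<phi> \<in> set xs" "\<psi> \<in> set xs" "Imp \<phi> \<psi> \<in> set xs"
    using Imp.prems subforms_refl by auto
  with Imp show ?case by (simp add: I)
qed

section \<open>Reflexivity and symmetry from T and B\<close>

lemma acc_refl:
  assumes "\<And>\<phi>. Imp (Box \<phi>) \<phi> \<in> L" "S \<in> states"
  shows "acc S S"
proof (rule ccontr)
  assume "\<not> acc S S"
  then have "Imp (char_form S) (Box (Neg (char_form S))) \<in> L"
    by (simp add: acc_def)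
  \<comment> \<open>T turns the boxed negation into the negation, so the description of
    \<open>S\<close> refutes itself.\<close>
  then have "Neg (char_form S) \<in> L"
    by (rule conseq2[OF _ assms(1)[of "Neg (char_form S)"]]) auto
  with assms(2) show False by (simp add: states_def)
qed

lemma acc_sym:
  assumes "\<And>\<phi>. Imp \<phi> (Box (Dia \<phi>)) \<in> L" "acc S U"
  shows "acc U S"
proof (rule ccontr)
  assume "\<not> acc U S"
  then have "Imp (char_form U) (Box (Neg (char_form S))) \<in> L"
    by (simp add: acc_def)
  then have "Imp (Dia (char_form S)) (Neg (char_form U)) \<in> L"
    by (rule conseq2[OF _ dual[of "char_form S"]]) auto
  \<comment> \<open>B leads from \<open>char_form S\<close> to
    \<open>Box (Dia (char_form S))\<close>, and the boxed implication leads on to the negation of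
    \<open>acc S U\<close>.\<close>
  from box_mono[OF this] have "Imp (char_form S) (Box (Neg (char_form U))) \<in> L"
    by (rule conseq2[OF assms(1)[of "char_form S"]]) auto
  with assms(2) show False by (simp add: acc_def)
qed

end

lemma KTB_finite_model:
  assumes "\<phi> \<notin> KTB"
  obtains W :: "'p mform set set" and R V w where "finite W" "w \<in> W"
    "\<And>u. u \<in> W \<Longrightarrow> R u u" "\<And>u v. R u v \<Longrightarrow> R v u" "\<not> sat W R V w (\<phi> :: 'p mform)"
proof -
  obtain xs where xs: "set xs = subforms \<phi>"
    using finite_list[OF finite_subforms] ..
  interpret finite_canonical KTB xs
    by unfold_locales (rule normal_modal_logic_KTB)
  have "\<phi> \<in> set xs"
    by (simp add: xs subforms_refl)
  with assms obtain w where w: "w \<in> states" "\<phi> \<notin> w"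
    by (auto simp: mem_iff_states)
  show ?thesis
  proof (rule that[OF finite_states w(1), of acc "\<lambda>p S. Var p \<in> S"])
    show "\<And>u. u \<in> states \<Longrightarrow> acc u u"
      by (rule acc_refl[OF KTB_T])
    show "\<And>u v. acc u v \<Longrightarrow> acc v u"
      by (rule acc_sym[OF KTB_B])
    show "\<not> sat states acc (\<lambda>p S. Var p \<in> S) w \<phi>"
      using w xs by (simp add: truth)
  qed
qed


section \<open>Representing finite frames in Boolean algebras\<close>

lemma inf_compl_eq:
  fixes x a b :: "'b::boolean_algebra"
  assumes "x \<le> b"
  shows "x = (x \<sqinter> a) \<squnion> (x \<sqinter> (b \<sqinter> - a))"
proof -
  have "(x \<sqinter> a) \<squnion> (x \<sqinter> (b \<sqinter> - a)) = (x \<sqinter> a) \<squnion> (x \<sqinter> - a)"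
    using assms by (simp add: inf.absorb1 flip: inf.assoc)
  then show ?thesis
    by (simp add: inf_sup_distrib1[symmetric])
qed

text \<open>Take \<open>a\<close> strictly between bottom and \<open>b\<close>. Every element below
  \<open>b\<close> is the join of its parts inside and outside \<open>a\<close>, so one of the two
  pieces has infinitely many elements below it; the other piece is split off.\<close>

lemma infinite_below_split:
  fixes b :: "'b::boolean_algebra"
  assumes "infinite {x. x \<le> b}"
  obtains a where "a \<noteq> \<bottom>" "a \<le> b" "infinite {x. x \<le> b \<sqinter> - a}"
proof -
  have "infinite ({x. x \<le> b} - {\<bottom>, b})"
    using assms by simp
  then obtain a where "a \<in> {x. x \<le> b} - {\<bottom>, b}"
    by (metis ex_in_conv finite.emptyI)
  then have a: "a \<le> b" "a \<noteq> \<bottom>" "a \<noteq> b" by auto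
  have "infinite {x. x \<le> a} \<or> infinite {x. x \<le> b \<sqinter> - a}"
  proof (rule ccontr)
    assume "\<not> ?thesis"
    then have "finite ((\<lambda>(y, z). y \<squnion> z) ` ({x. x \<le> a} \<times> {x. x \<le> b \<sqinter> - a}))"
      by simp
    moreover have "{x. x \<le> b} \<subseteq> (\<lambda>(y, z). y \<squnion> z) ` ({x. x \<le> a} \<times> {x. x \<le> b \<sqinter> - a})"
    proof
      fix x assume "x \<in> {x. x \<le> b}"
      then show "x \<in> (\<lambda>(y, z). y \<squnion> z) ` ({x. x \<le> a} \<times> {x. x \<le> b \<sqinter> - a})"
        by (intro image_eqI[of _ _ "(x \<sqinter> a, x \<sqinter> (b \<sqinter> - a))"] SigmaI CollectI inf_le2)
          (use inf_compl_eq[of x b a] in auto)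
    qed
    ultimately show False
      using assms finite_subset by blast
  qed
  then show ?thesis
  proof
    assume *: "infinite {x. x \<le> a}"
    \<comment> \<open>Complementing twice inside \<open>b\<close> returns \<open>a\<close>, so the
      two pieces can swap roles.\<close>
    have eq: "b \<sqinter> - (b \<sqinter> - a) = a"
      using a(1) by (simp add: inf_sup_distrib1 inf.absorb2)
    have "b \<sqinter> - a \<noteq> \<bottom>"
    proof
      assume "b \<sqinter> - a = \<bottom>"
      with eq a(3) show False by simp
    qed
    moreover have "infinite {x. x \<le> b \<sqinter> - (b \<sqinter> - a)}"
      unfolding eq by (rule *)
    ultimately show ?thesis
      by (intro that[of "b \<sqinter> - a"] inf_le1)
  next
    assume "infinite {x. x \<le> b \<sqinter> - a}"
    then show ?thesis
      by (rule that[OF a(2,1)])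
  qed
qed

text \<open>One element is split off and the rest of the family is found below the infinite
  remainder, disjoint from it; hence the induction varies \<open>b\<close>.\<close>

lemma disjoint_family_below:
  fixes b :: "'b::boolean_algebra"
  assumes "finite A" "infinite {x. x \<le> b}"
  shows "\<exists>f. (\<forall>i\<in>A. f i \<noteq> \<bottom> \<and> f i \<le> b) \<and> (\<forall>i\<in>A. \<forall>j\<in>A. i \<noteq> j \<longrightarrow> f i \<sqinter> f j = \<bottom>)"
  using assms
proof (induction A arbitrary: b rule: finite_induct)
  case (insert i A)
  obtain a where a: "a \<noteq> \<bottom>" "a \<le> b" "infinite {x. x \<le> b \<sqinter> - a}"
    using infinite_below_split[OF insert.prems] by blast
  obtain f where f: "\<And>j. j \<in> A \<Longrightarrow> f j \<noteq> \<bottom>" "\<And>j. j \<in> A \<Longrightarrow> f j \<le> b \<sqinter> - a"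
      "\<And>j k. j \<in> A \<Longrightarrow> k \<in> A \<Longrightarrow> j \<noteq> k \<Longrightarrow> f j \<sqinter> f k = \<bottom>"
    using insert.IH[OF a(3)] by blast
  have "f j \<sqinter> a = \<bottom>" if "j \<in> A" for j
    using f(2)[OF that] by (simp add: inf_shunt)
  moreover from this have "a \<sqinter> f j = \<bottom>" if "j \<in> A" for j
    using that by (simp add: inf.commute)
  ultimately show ?case
    using a f insert.hyps by (intro exI[of _ "f(i := a)"]) auto
qed simp

text \<open>Being disjoint from \<open>b\<close> means lying below its complement, so this case of
  infinite distributivity is just the universal property of the join.\<close>

lemma Sup_inf_eq_bot:
  fixes A :: "'b::{boolean_algebra,complete_lattice} set"
  shows "\<Squnion>A \<sqinter> b = \<bottom> \<longleftrightarrow> (\<forall>a\<in>A. a \<sqinter> b = \<bottom>)"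
  by (simp add: inf_shunt Sup_le_iff)

lemma frame_representation:
  fixes R :: "'w \<Rightarrow> 'w \<Rightarrow> bool"
  assumes "finite W" "infinite (UNIV :: 'b::{boolean_algebra,complete_lattice} set)"
    and refl: "\<And>u. u \<in> W \<Longrightarrow> R u u" and sym: "\<And>u v. R u v \<Longrightarrow> R v u"
  obtains b :: "'w \<Rightarrow> 'b::{boolean_algebra,complete_lattice}"
    and v :: "'w set \<Rightarrow> 'b::{boolean_algebra,complete_lattice}"
  where "\<And>w. w \<in> W \<Longrightarrow> b w \<noteq> \<bottom>"
    "\<And>w u. w \<in> W \<Longrightarrow> u \<in> W \<Longrightarrow> b w \<sqinter> b u \<noteq> \<bottom> \<longleftrightarrow> R w u"
    "\<And>w S. w \<in> W \<Longrightarrow> b w \<le> v S \<longleftrightarrow> w \<in> S"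
proof -
  have "finite (W \<times> W)" "infinite {x :: 'b. x \<le> \<top>}"
    using assms by auto
  from disjoint_family_below[OF this] obtain f :: "'w \<times> 'w \<Rightarrow> 'b" where
    "(\<forall>e\<in>W \<times> W. f e \<noteq> \<bottom> \<and> f e \<le> \<top>) \<and>
     (\<forall>e\<in>W \<times> W. \<forall>e'\<in>W \<times> W. e \<noteq> e' \<longrightarrow> f e \<sqinter> f e' = \<bottom>)" ..
  then have f0: "\<And>e. e \<in> W \<times> W \<Longrightarrow> f e \<noteq> \<bottom>"
    and f: "\<And>e e'. e \<in> W \<times> W \<Longrightarrow> e' \<in> W \<times> W \<Longrightarrow> e \<noteq> e' \<Longrightarrow> f e \<sqinter> f e' = \<bottom>"
    by (blast, blast)
  \<comment> \<open>The edges at \<open>w\<close>, as ordered pairs. For adjacent distinct worlds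
    both orientations are shared; this duplication does no harm.\<close>
  define E where "E w = {(x, y). x \<in> W \<and> y \<in> W \<and> R x y \<and> (x = w \<or> y = w)}" for w
  define b where "b w = (\<Squnion>e\<in>E w. f e)" for w
  define v where "v S = (\<Squnion>w\<in>S \<inter> W. b w)" for S
  have EW: "E w \<subseteq> W \<times> W" for w
    by (auto simp: E_def)
  have loop: "(w, w) \<in> E w" if "w \<in> W" for w
    using that refl by (auto simp: E_def)
  have disj: "f e \<sqinter> b w = \<bottom> \<longleftrightarrow> e \<notin> E w" if "e \<in> W \<times> W" for e w
  proof -
    have "f e \<sqinter> b w = \<bottom> \<longleftrightarrow> (\<forall>e'\<in>E w. f e' \<sqinter> f e = \<bottom>)"
      unfolding b_def inf.commute[of "f e"] Sup_inf_eq_bot by simp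
    also have "\<dots> \<longleftrightarrow> e \<notin> E w"
      using f[OF _ that] f0[OF that] EW[of w] by (metis inf.idem subsetD)
    finally show ?thesis .
  qed
  show ?thesis
  proof
    fix w assume w: "w \<in> W"
    show "b w \<noteq> \<bottom>"
      using disj[of "(w, w)" w] loop w by auto
    fix u assume u: "u \<in> W"
    have "b w \<sqinter> b u = \<bottom> \<longleftrightarrow> (\<forall>e\<in>E w. f e \<sqinter> b u = \<bottom>)"
      unfolding b_def[of w] Sup_inf_eq_bot by simp
    also have "\<dots> \<longleftrightarrow> E w \<inter> E u = {}"
      using disj EW[of w] by (auto simp: subset_iff)
    \<comment> \<open>A common edge of distinct worlds joins them; for equal worlds the loop is
      common.\<close>
    also have "\<dots> \<longleftrightarrow> \<not> R w u"
      using w u refl sym unfolding E_def by blast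
    finally show "b w \<sqinter> b u \<noteq> \<bottom> \<longleftrightarrow> R w u" by blast
  next
    fix w S assume w: "w \<in> W"
    show "b w \<le> v S \<longleftrightarrow> w \<in> S"
    proof
      assume "w \<in> S"
      then show "b w \<le> v S" using w by (auto simp: v_def intro: SUP_upper)
    next
      assume le: "b w \<le> v S"
      show "w \<in> S"
      proof (rule ccontr)
        assume "w \<notin> S"
        \<comment> \<open>The loop at \<open>w\<close> is an edge of no other world.\<close>
        then have "f (w, w) \<sqinter> b u = \<bottom>" if "u \<in> S \<inter> W" for u
          using that w disj[of "(w, w)" u] by (auto simp: E_def)
        then have "v S \<sqinter> f (w, w) = \<bottom>"
          unfolding v_def Sup_inf_eq_bot by (auto simp: inf.commute)
        moreover have "f (w, w) \<le> v S"
          using loop[OF w] le unfolding b_def by (meson SUP_upper order_trans)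
        ultimately show False
          using f0[of "(w, w)"] w by (simp add: inf.absorb2)
      qed
    qed
  qed
qed


section \<open>Sentences of arbitrary Boolean value\<close>

lemma elts_inject: "elts x = elts y \<longleftrightarrow> x = y"
  using extensionality[of x y] by (auto simp: elts_def)

lemma upair_inject: "upair a b = upair a' b' \<longleftrightarrow> {a, b} = {a', b'}"
  by (metis elts_inject elts_upair)

lemma opair_inject: "opair a b = opair a' b' \<longleftrightarrow> a = a' \<and> b = b'"
  unfolding opair_def by (auto simp: upair_inject doubleton_eq_iff)

lemma empty_set_exists: "\<exists>e :: 'v::set_universe. elts e = {}"
proof -
  obtain s :: 'v where "\<forall>x. x \<in>\<^sub>V s \<longleftrightarrow> x \<in>\<^sub>V undefined \<and> False"
    using separation[of undefined "\<lambda>_. False"] by blast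
  then show ?thesis by (auto simp: elts_def)
qed

lemma Sent_bval_surj:
  fixes c :: "'b::{boolean_algebra,complete_lattice} \<Rightarrow> 'v::set_universe"
  assumes "inj c"
  shows "\<exists>\<phi>\<in>Sent c. bval c \<phi> = b"
proof -
  obtain e :: 'v where e: "elts e = {}"
    using empty_set_exists by blast
  \<comment> \<open>The ordinals 1 and 2: \<open>e\<close> enters the hierarchy at level 1, and
    \<open>x\<close>, the function with domain {\<open>e\<close>} and value \<open>b\<close>, at
    level 2.\<close>
  define one where "one = upair e e"
  define two where "two = upair e one"
  define x where "x = upair (opair e (c b)) (opair e (c b))"
  have mem: "z \<in>\<^sub>V y \<longleftrightarrow> z \<in> elts y" for y z :: 'v
    by (simp add: elts_def)
  have ord: "ordinal one" "ordinal two"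
    using e by (auto simp: ordinal_def transitive_def one_def two_def)
  have fe: "is_function e" "fdom e = {}" "fran e = {}"
    using e by (auto simp: is_function_def fdom_def fran_def mem)
  have fx: "is_function x" "fdom x = {e}" "fran x = {c b}"
    by (auto simp: is_function_def fdom_def fran_def mem x_def opair_inject)
  have "e \<in> VB_level c one"
    by (subst VB_level.simps) (simp add: fe one_def)
  then have "x \<in> VB_level c two" "e \<in> VB_level c one"
    by (subst VB_level.simps, auto simp: fx two_def)
  then have VB: "x \<in> VB c" "e \<in> VB c"
    using ord by (auto simp: VB_def)
  have val: "val c x e = b"
    unfolding val_def mem x_def using assms by (auto simp: opair_inject dest: injD)
  \<comment> \<open>Both meets range over the empty domain of \<open>e\<close>.\<close>
  have "beq c e e = \<top>"
    by (subst beq.simps) (simp add: fe)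
  then have "bmem c e x = b"
    by (subst bmem.simps) (simp add: fx val)
  then show ?thesis
    using VB by (intro bexI[of _ "FMem (Const e) (Const x)"]) (auto simp: Sent_def)
qed


section \<open>The logic of translation models\<close>

theorem theorem6p10:
  fixes c :: "'b::{boolean_algebra,complete_lattice} \<Rightarrow> 'v::set_universe"
  assumes "coded_as_set c"
    and "infinite (UNIV :: 'b set)"
  shows "(Log_sub_sharp c :: 'p::countable mform set) = KTB"
proof
  show "KTB \<subseteq> (Log_sub_sharp c :: 'p mform set)"
    unfolding Log_sub_sharp_def translation_valid_def translation_sat_def
  proof (intro subsetI CollectI allI impI ballI)
    fix \<phi> :: "'p mform" and W :: "'b set" and T :: "'p \<Rightarrow> 'v form" and b
    assume \<phi>: "\<phi> \<in> KTB" and W: "W \<subseteq> UNIV - {\<bottom>}" and b: "b \<in> W"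
    show "sat W (\<lambda>a b. a \<sqinter> b \<noteq> \<bottom>) (\<lambda>p b. b \<le> induced_val c T p) b \<phi>"
      \<comment> \<open>Excluding bottom from \<open>W\<close> makes meeting reflexive; it is
        symmetric by commutativity.\<close>
      by (rule KTB_sound[OF \<phi> b]) (use W in \<open>auto simp: inf.commute\<close>)
  qed
next
  show "(Log_sub_sharp c :: 'p mform set) \<subseteq> KTB"
  proof (rule subsetI, rule ccontr)
    fix \<phi> :: "'p mform"
    assume Log: "\<phi> \<in> Log_sub_sharp c" and "\<phi> \<notin> KTB"
    obtain W :: "'p mform set set" and R V w where fin: "finite W" and w: "w \<in> W"
      and R: "\<And>u. u \<in> W \<Longrightarrow> R u u" "\<And>u v. R u v \<Longrightarrow> R v u"
      and unsat: "\<not> sat W R V w \<phi>"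
      by (rule KTB_finite_model[OF \<open>\<phi> \<notin> KTB\<close>]) (rule that)
    obtain b :: "'p mform set \<Rightarrow> 'b" and v where b0: "\<And>w. w \<in> W \<Longrightarrow> b w \<noteq> \<bottom>"
      and bR: "\<And>w u. w \<in> W \<Longrightarrow> u \<in> W \<Longrightarrow> b w \<sqinter> b u \<noteq> \<bottom> \<longleftrightarrow> R w u"
      and bv: "\<And>w S. w \<in> W \<Longrightarrow> b w \<le> v S \<longleftrightarrow> w \<in> S"
      by (rule frame_representation[where R = R, OF fin assms(2) R]) (assumption, assumption, rule that)
    have "inj c"
      using assms(1) by (simp add: coded_as_set_def)
    then have "\<exists>\<theta>. \<theta> \<in> Sent c \<and> bval c \<theta> = v {w. V p w}" for p
      using Sent_bval_surj[of c "v {w. V p w}"] by (simp only: Bex_def)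
    \<comment> \<open>Each variable is translated to a sentence whose value encodes its truth set,
      so lying below that value means satisfying the variable.\<close>
    then have "\<exists>T. \<forall>p. T p \<in> Sent c \<and> bval c (T p) = v {w. V p w}"
      by (intro choice allI)
    then obtain T where T: "\<And>p. T p \<in> Sent c" "\<And>p. bval c (T p) = v {w. V p w}"
      by auto
    have "sat (b ` W) (\<lambda>a b. a \<sqinter> b \<noteq> \<bottom>) (\<lambda>p b. b \<le> induced_val c T p) (b w) \<phi> \<longleftrightarrow> sat W R V w \<phi>"
      by (rule sat_cong_image[OF _ _ w]) (simp_all add: bR bv induced_val_def T)
    moreover have "translation_valid c (b ` W) T \<phi>"
    proof -
      have "b ` W \<noteq> {}" "b ` W \<subseteq> UNIV - {\<bottom>}" "translation c T"
        using w b0 T(1) by (auto simp: translation_def)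
      with Log show ?thesis
        by (simp add: Log_sub_sharp_def)
    qed
    ultimately show False
      using w unsat by (simp add: translation_valid_def translation_sat_def)
  qed
qed

end
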